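(* Let $0<\alpha\le 2$, $-1\le\beta\le1$ and $Z\sim S(\alpha,\beta)$. Then $Z\in\mathcal{D}^-$ if and only if either (a) $\alpha=1$ and $\beta\ge0$, or (b) $\alpha<1$ and $\beta=1$.
   Context: For $0<\alpha\le2$ and $-1\le\beta\le1$, $Z\sim S(\alpha,\beta)$ means $Z$ has characteristic function $E e^{iuZ}=\exp\big(-|u|^\alpha[1-i\beta\tan(\pi\alpha/2)\,\mathrm{sign}(u)]\big)$ for $\alpha\ne1$, and $E e^{iuZ}=\exp\big(-|u|[1+\tfrac{2i\beta}{\pi}\mathrm{sign}(u)\ln|u|]\big)$ for $\alpha=1$, $u\in\mathbb{R}$. For real random variables, $X \le_{st} Y$ means $P(X\le t)\ge P(Y\le t)$ for all $t\in\mathbb{R}$. A real random variable $X$ (equivalently its distribution function $F_X$) belongs to $\mathcal{D}^-$ if for every $n\in\mathbb{N}$, all $\theta_1,\dots,\theta_n\ge 0$ with $\sum_{i=1}^n\theta_i=1$, and i.i.d. random variables $X_1,\dots,X_n$ with distribution $F_X$, we have $X_1\le_{st}\sum_{i=1}^n\theta_iX_i$. *)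

theory Defs
  imports "HOL-Probability.Probability"
begin

definition stable_cf :: "real \<Rightarrow> real \<Rightarrow> real \<Rightarrow> complex" where
  "stable_cf \<alpha> \<beta> u =
     (if \<alpha> \<noteq> 1 then
        exp (- complex_of_real (\<bar>u\<bar> powr \<alpha>) *
             (1 - \<i> * complex_of_real (\<beta> * tan (pi * \<alpha> / 2) * sgn u)))
      else
        exp (- complex_of_real \<bar>u\<bar> *
             (1 + \<i> * complex_of_real (2 * \<beta> / pi * sgn u * ln \<bar>u\<bar>))))"

definition is_stable :: "real measure \<Rightarrow> real \<Rightarrow> real \<Rightarrow> bool" where
  "is_stable M \<alpha> \<beta> \<longleftrightarrow> real_distribution M \<and> (\<forall>u. char M u = stable_cf \<alpha> \<beta> u)"

definition st_le :: "real measure \<Rightarrow> real measure \<Rightarrow> bool" where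
  "st_le M N \<longleftrightarrow> (\<forall>t::real. measure N {..t} \<le> measure M {..t})"

definition weighted_iid_sum :: "real measure \<Rightarrow> nat \<Rightarrow> (nat \<Rightarrow> real) \<Rightarrow> real measure" where
  "weighted_iid_sum M n \<theta> =
     distr (PiM {..<n} (\<lambda>_. M)) borel (\<lambda>x. \<Sum>i<n. \<theta> i * x i)"

definition Dminus :: "real measure \<Rightarrow> bool" where
  "Dminus M \<longleftrightarrow>
     (\<forall>n::nat. \<forall>\<theta>::nat \<Rightarrow> real.
        (\<forall>i<n. 0 \<le> \<theta> i) \<and> (\<Sum>i<n. \<theta> i) = 1 \<longrightarrow> st_le M (weighted_iid_sum M n \<theta>))"

end

theory Submission
  imports Defs "HOL-Complex_Analysis.Conformal_Mappings"
begin

text \<open>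
  By uniqueness of characteristic functions, a convex combination of i.i.d. copies of \<open>Z\<close> has
  the law of \<open>c Z\<close> with \<open>c\<^sup>\<alpha> = \<Sum> \<theta>\<^sub>i\<^sup>\<alpha>\<close> if \<open>\<alpha> \<noteq> 1\<close>, and of \<open>Z\<close> shifted by
  \<open>2\<beta>/\<pi>\<close> times the entropy of \<open>\<theta>\<close> if \<open>\<alpha> = 1\<close>. The latter settles \<open>\<alpha> = 1\<close>. For
  \<open>\<alpha> \<noteq> 1\<close>, iterating the comparison of \<open>Z\<close> with \<open>c Z\<close> shows that membership forces
  \<open>Z \<ge> 0\<close> if \<open>\<alpha> < 1\<close> and \<open>Z \<le> 0\<close> if \<open>\<alpha> > 1\<close>; conversely \<open>Z \<ge> 0\<close> and
  \<open>c \<ge> 1\<close> suffice. It remains to see that \<open>Z \<ge> 0\<close> is equivalent to \<open>\<alpha> < 1\<close> and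
  \<open>\<beta> = 1\<close>. If \<open>Z \<ge> 0\<close>, analytic continuation from the boundary gives
  \<open>E exp(-sZ) = exp(-k s\<^sup>\<alpha>)\<close> for \<open>s > 0\<close>, where \<open>k\<close> must be real and nonnegative. Conversely,
  for \<open>\<beta> = 1\<close> the characteristic function extends boundedly to a half-plane, and Liouville's
  theorem shows that the contribution of \<open>Z < 0\<close> vanishes.
\<close>

subsection \<open>Laplace transforms on a half-plane\<close>

text \<open>The weight \<open>g\<close> stands in for restricting the measure: with indicators as
  weights and \<open>X\<close> the identity or \<open>uminus\<close>, one definition covers both the
  nonnegative and the negative part of a law on the line.\<close>

definition half_laplace :: "'a measure \<Rightarrow> ('a \<Rightarrow> complex) \<Rightarrow> ('a \<Rightarrow> real) \<Rightarrow> complex \<Rightarrow> complex" where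
  "half_laplace M g X z = (\<integral>x. g x * exp (- (z * of_real (X x))) \<partial>M)"

context
  fixes M :: "'a measure" and g :: "'a \<Rightarrow> complex" and X :: "'a \<Rightarrow> real"
  assumes g: "integrable M g" and X: "X \<in> borel_measurable M"
    and X_nonneg: "\<And>x. g x \<noteq> 0 \<Longrightarrow> 0 \<le> X x"
begin

lemma weight_measurable: "g \<in> borel_measurable M"
  using g by (rule borel_measurable_integrable)

lemma kernel_norm_le: "0 \<le> Re z \<Longrightarrow> norm (g x * exp (- (z * of_real (X x)))) \<le> norm (g x)"
  using X_nonneg[of x] by (cases "g x = 0") (auto simp: norm_mult intro!: mult_left_le)

lemma kernel_integrable:
  assumes "0 \<le> Re z"
  shows "integrable M (\<lambda>x. g x * exp (- (z * of_real (X x))))"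
  by (rule Bochner_Integration.integrable_bound[OF g])
     (use X weight_measurable kernel_norm_le[OF assms] in \<open>auto\<close>)

lemma norm_half_laplace_le:
  assumes "0 \<le> Re z"
  shows "norm (half_laplace M g X z) \<le> (\<integral>x. norm (g x) \<partial>M)"
  unfolding half_laplace_def
  by (rule order_trans[OF integral_norm_bound])
     (intro integral_mono integrable_norm g kernel_integrable kernel_norm_le assms)

text \<open>Domination by \<open>norm (g x)\<close> persists up to the imaginary axis, where the
  transform becomes a characteristic function.\<close>

lemma continuous_on_half_laplace: "continuous_on {z. 0 \<le> Re z} (half_laplace M g X)"
  unfolding continuous_on_sequentially comp_def
proof safe
  fix Y z assume Y: "\<forall>n. Y n \<in> {z. 0 \<le> Re z}" "Y \<longlonglongrightarrow> z" "0 \<le> Re z"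
  show "(\<lambda>n. half_laplace M g X (Y n)) \<longlonglongrightarrow> half_laplace M g X z"
    unfolding half_laplace_def
    by (rule integral_dominated_convergence[where w = "\<lambda>x. norm (g x)"])
       (use X weight_measurable kernel_norm_le Y in \<open>auto intro!: g tendsto_intros\<close>)
qed

text \<open>Dominated convergence again. Positivity of \<open>X\<close> is strict because mass of
  \<open>g\<close> on \<open>X = 0\<close> would survive in the limit.\<close>

lemma half_laplace_tendsto_0:
  assumes Y: "filterlim (\<lambda>n. Re (Y n)) at_top sequentially" "\<And>n. 0 \<le> Re (Y n)"
    and pos: "\<And>x. g x \<noteq> 0 \<Longrightarrow> 0 < X x"
  shows "(\<lambda>n. half_laplace M g X (Y n)) \<longlonglongrightarrow> 0"
proof -
  have "(\<lambda>n. half_laplace M g X (Y n)) \<longlonglongrightarrow> (\<integral>x. 0 \<partial>M)"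
    unfolding half_laplace_def
  proof (rule integral_dominated_convergence[where w = "\<lambda>x. norm (g x)"])
    have "(\<lambda>n. g x * exp (- (Y n * of_real (X x)))) \<longlonglongrightarrow> 0" for x
    proof (cases "g x = 0")
      case False
      have "filterlim (\<lambda>n. X x * Re (Y n)) at_top sequentially"
        by (rule filterlim_tendsto_pos_mult_at_top[OF tendsto_const pos[OF False] Y(1)])
      hence "(\<lambda>n. norm (exp (- (Y n * of_real (X x))))) \<longlonglongrightarrow> 0"
        by (auto simp: mult.commute filterlim_uminus_at_bot intro!: filterlim_compose[OF exp_at_bot])
      hence "(\<lambda>n. exp (- (Y n * of_real (X x)))) \<longlonglongrightarrow> 0"
        by (rule tendsto_norm_zero_cancel)
      from tendsto_mult_left[OF this, of "g x"] show ?thesis by simp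
    qed simp
    thus "AE x in M. (\<lambda>n. g x * exp (- (Y n * of_real (X x)))) \<longlonglongrightarrow> 0" by simp
  qed (use X weight_measurable kernel_norm_le Y(2) in \<open>auto intro!: g\<close>)
  thus ?thesis by simp
qed

text \<open>Differentiation under the integral. The exponential decay for \<open>0 < Re z\<close>
  absorbs the factor \<open>X x\<close> that the derivative produces, so the difference quotients
  have a common integrable bound.\<close>

lemma half_laplace_holomorphic: "half_laplace M g X holomorphic_on {z. 0 < Re z}"
  unfolding holomorphic_on_def
proof
  fix z :: complex assume z: "z \<in> {z. 0 < Re z}"
  define D where "D = (\<integral>x. g x * (- of_real (X x) * exp (- (z * of_real (X x)))) \<partial>M)"
  \<comment> \<open>With increments of size at most \<open>Re z / 2\<close>, the quotient loses at
    most half of the decay rate; what is left, \<open>t * exp (- (Re z / 2 * t))\<close>, is bounded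
    by \<open>2 / Re z\<close>.\<close>
  define U where "U = ball z (Re z / 2)"
  have U: "open U" "z \<in> U" "\<And>y. y \<in> U \<Longrightarrow> 0 \<le> Re y"
  proof -
    show "0 \<le> Re y" if "y \<in> U" for y
      using that abs_Re_le_cmod[of "z - y"] by (auto simp: U_def dist_norm)
  qed (use z in \<open>auto simp: U_def\<close>)
  have "((\<lambda>y. (half_laplace M g X y - half_laplace M g X z) / (y - z)) \<longlongrightarrow> D) (at z within U)"
    unfolding tendsto_at_iff_sequentially comp_def
  proof safe
    fix Y assume Y: "\<forall>i. Y i \<in> U - {z}" "Y \<longlonglongrightarrow> z"
    have w: "integrable M (\<lambda>x. norm (g x) * (2 / Re z))"
      by (intro integrable_mult_left integrable_norm g)
    have "(half_laplace M g X (Y n) - half_laplace M g X z) / (Y n - z) =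
      (\<integral>x. g x * ((exp (- (Y n * of_real (X x))) - exp (- (z * of_real (X x)))) / (Y n - z)) \<partial>M)" for n
      using Y(1) U z unfolding half_laplace_def
      by (subst Bochner_Integration.integral_diff[symmetric])
         (auto intro!: kernel_integrable simp: ring_distribs diff_divide_distrib
            simp flip: integral_divide_zero)
    moreover have "(\<lambda>n. \<integral>x. g x * ((exp (- (Y n * of_real (X x))) - exp (- (z * of_real (X x)))) / (Y n - z)) \<partial>M)
      \<longlonglongrightarrow> D"
      unfolding D_def
    proof (rule integral_dominated_convergence[where w = "\<lambda>x. norm (g x) * (2 / Re z)"])
      have "(\<lambda>n. (exp (- (Y n * of_real (X x))) - exp (- (z * of_real (X x)))) / (Y n - z))
          \<longlonglongrightarrow> - of_real (X x) * exp (- (z * of_real (X x)))" for x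
      proof -
        have "((\<lambda>y. exp (- (y * of_real (X x)))) has_field_derivative
            - of_real (X x) * exp (- (z * of_real (X x)))) (at z within U)"
          by (auto intro!: derivative_eq_intros)
        thus ?thesis
          using Y unfolding has_field_derivative_iff tendsto_at_iff_sequentially comp_def by blast
      qed
      hence "(\<lambda>n. g x * ((exp (- (Y n * of_real (X x))) - exp (- (z * of_real (X x)))) / (Y n - z)))
          \<longlonglongrightarrow> g x * (- of_real (X x) * exp (- (z * of_real (X x))))" for x
        by (rule tendsto_mult_left)
      thus "AE x in M. (\<lambda>n. g x * ((exp (- (Y n * of_real (X x))) - exp (- (z * of_real (X x)))) / (Y n - z)))
          \<longlonglongrightarrow> g x * (- of_real (X x) * exp (- (z * of_real (X x))))"
        by (rule always_eventually[OF allI])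
      fix n
      define h where "h = Y n - z"
      have h: "h \<noteq> 0" "norm h \<le> Re z / 2"
        using Y(1) by (auto simp: h_def U_def dist_norm norm_minus_commute dest!: spec[of _ n] less_imp_le)
      have "norm ((exp (- (Y n * of_real (X x))) - exp (- (z * of_real (X x)))) / (Y n - z)) \<le> 2 / Re z"
        if x: "g x \<noteq> 0" for x
      proof -
        define t where "t = X x"
        have t: "0 \<le> t" using X_nonneg[OF x] by (simp add: t_def)
        have "(exp (- (Y n * of_real t)) - exp (- (z * of_real t))) / (Y n - z)
            = exp (- (z * of_real t)) * (exp (- (h * of_real t)) - 1) / h"
          by (simp add: h_def algebra_simps flip: exp_add)
        also have "norm \<dots> = exp (- (Re z * t)) * norm (exp (- (h * of_real t)) - 1) / norm h"
          by (simp add: norm_mult norm_divide)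
        also have "\<dots> \<le> exp (- (Re z * t)) * (exp (Re z / 2 * t) * (norm h * t)) / norm h"
        proof (intro divide_right_mono mult_left_mono)
          have "norm (exp (- (h * of_real t)) - 1) \<le> exp \<bar>Re h * t\<bar> * (norm h * t)"
            using Taylor_exp[of "- (h * of_real t)" 0] t by (simp add: norm_mult)
          also have "\<dots> \<le> exp (Re z / 2 * t) * (norm h * t)"
          proof -
            have "\<bar>Re h\<bar> * t \<le> Re z / 2 * t"
              using t h abs_Re_le_cmod[of h] by (intro mult_right_mono) auto
            hence "\<bar>Re h * t\<bar> \<le> Re z / 2 * t" using t by (simp add: abs_mult)
            thus ?thesis using t by (intro mult_right_mono) auto
          qed
          finally show "norm (exp (- (h * of_real t)) - 1) \<le> exp (Re z / 2 * t) * (norm h * t)" .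
        qed auto
        also have "\<dots> = t * exp (- (Re z / 2 * t))"
          using h by (simp add: field_simps flip: exp_add)
        also have "\<dots> \<le> 2 / Re z"
        proof -
          have "Re z / 2 * t \<le> exp (Re z / 2 * t)"
            using exp_ge_add_one_self[of "Re z / 2 * t"] by linarith
          thus ?thesis using z by (simp add: exp_minus field_simps)
        qed
        finally show ?thesis by (simp add: t_def)
      qed
      thus "AE x in M. norm (g x * ((exp (- (Y n * of_real (X x))) - exp (- (z * of_real (X x)))) / (Y n - z)))
        \<le> norm (g x) * (2 / Re z)"
        unfolding norm_mult by (intro always_eventually allI) (metis mult_left_mono mult_zero_left norm_ge_zero norm_zero order_refl)
    qed (use X weight_measurable w in \<open>auto\<close>)
    ultimately show "(\<lambda>n. (half_laplace M g X (Y n) - half_laplace M g X z) / (Y n - z)) \<longlonglongrightarrow> D"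
      by (simp only:)
  qed
  hence "(half_laplace M g X has_field_derivative D) (at z)"
    using U(1,2) unfolding has_field_derivative_iff by (metis at_within_open)
  thus "half_laplace M g X field_differentiable (at z within {z. 0 < Re z})"
    using field_differentiable_def field_differentiable_at_within by blast
qed

end

subsection \<open>Weighted sums of stable variables\<close>

lemma real_distribution_distr_borel:
  assumes "real_distribution M" "f \<in> borel_measurable borel"
  shows "real_distribution (distr M borel f)"
proof -
  interpret real_distribution M by fact
  show ?thesis using assms(2) by simp
qed

lemma char_distr_affine:
  assumes "real_distribution M"
  shows "char (distr M borel (\<lambda>x. a * x + b)) u = iexp (u * b) * char M (u * a)"
proof -
  interpret real_distribution M by fact
  have "char (distr M borel (\<lambda>x. a * x + b)) u = (CLINT x|M. iexp (u * (a * x + b)))"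
    by (simp add: char_def integral_distr)
  also have "\<dots> = (CLINT x|M. iexp (u * b) * iexp (u * a * x))"
    by (intro Bochner_Integration.integral_cong) (simp_all add: algebra_simps flip: exp_add)
  finally show ?thesis by (simp add: char_def)
qed

lemma cdf_distr_affine:
  assumes "real_distribution M" "0 < a"
  shows "cdf (distr M borel (\<lambda>x. a * x + b)) t = cdf M ((t - b) / a)"
proof -
  interpret real_distribution M by fact
  have "(\<lambda>x. a * x + b) -` {..t} = {..(t - b) / a}"
    using assms(2) by (auto simp: field_simps)
  thus ?thesis by (simp add: cdf_def measure_distr)
qed

lemma real_distribution_weighted_iid_sum:
  assumes "real_distribution M"
  shows "real_distribution (weighted_iid_sum M n \<theta>)"
proof -
  interpret real_distribution M by fact
  interpret P: prob_space "PiM {..<n} (\<lambda>_. M)"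
    by (intro prob_space_PiM prob_space_axioms)
  show ?thesis unfolding weighted_iid_sum_def by (intro P.real_distribution_distr) measurable
qed

lemma char_weighted_iid_sum:
  assumes "real_distribution M"
  shows "char (weighted_iid_sum M n \<theta>) u = (\<Prod>i<n. char M (u * \<theta> i))"
proof -
  interpret real_distribution M by fact
  interpret product_sigma_finite "\<lambda>_::nat. M" by standard
  have "char (weighted_iid_sum M n \<theta>) u = (CLINT x|PiM {..<n} (\<lambda>_. M). iexp (u * (\<Sum>i<n. \<theta> i * x i)))"
    unfolding char_def weighted_iid_sum_def by (subst integral_distr) auto
  also have "\<dots> = (CLINT x|PiM {..<n} (\<lambda>_. M). (\<Prod>i<n. iexp (u * \<theta> i * x i)))"
    by (simp add: sum_distrib_left mult.assoc flip: exp_sum)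
  also have "\<dots> = (\<Prod>i<n. CLINT x|M. iexp (u * \<theta> i * x))"
    by (intro product_integral_prod integrable_iexp) auto
  finally show ?thesis by (simp add: char_def)
qed

text \<open>The exponent is homogeneous of degree \<alpha> under positive scaling. The value
  \<open>c = 0\<close> is included so that vanishing weights are covered.\<close>

lemma stable_cf_scale:
  assumes "0 < \<alpha>" "\<alpha> \<noteq> 1" "0 \<le> c"
  shows "stable_cf \<alpha> \<beta> (u * c) =
    exp (complex_of_real (c powr \<alpha>) *
      (- complex_of_real (\<bar>u\<bar> powr \<alpha>) * (1 - \<i> * complex_of_real (\<beta> * tan (pi * \<alpha> / 2) * sgn u))))"
  using assms by (cases "c = 0") (simp_all add: stable_cf_def abs_mult powr_mult sgn_mult mult_ac)

text \<open>Characteristic functions multiply, so by homogeneity the exponents add up to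
  \<open>c powr \<alpha>\<close> times the original one. The \<open>+ 0\<close> matches the form of
  \<open>char_distr_affine\<close> and \<open>cdf_distr_affine\<close>.\<close>

lemma stable_weighted_iid_sum:
  assumes M: "is_stable M \<alpha> \<beta>" and \<alpha>: "0 < \<alpha>" "\<alpha> \<noteq> 1"
    and \<theta>: "\<And>i. i < n \<Longrightarrow> 0 \<le> \<theta> i" and n: "(\<Sum>i<n. \<theta> i powr \<alpha>) = c powr \<alpha>" "0 \<le> c"
  shows "weighted_iid_sum M n \<theta> = distr M borel (\<lambda>x. c * x + 0)"
proof (rule Levy_uniqueness)
  have rd: "real_distribution M" using M by (simp add: is_stable_def)
  show "real_distribution (weighted_iid_sum M n \<theta>)"
    by (rule real_distribution_weighted_iid_sum[OF rd])
  show "real_distribution (distr M borel (\<lambda>x. c * x + 0))"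
    by (rule real_distribution_distr_borel[OF rd]) simp
  show "char (weighted_iid_sum M n \<theta>) = char (distr M borel (\<lambda>x. c * x + 0))"
  proof
    fix u
    define E where "E = - complex_of_real (\<bar>u\<bar> powr \<alpha>) *
      (1 - \<i> * complex_of_real (\<beta> * tan (pi * \<alpha> / 2) * sgn u))"
    have "char (weighted_iid_sum M n \<theta>) u = (\<Prod>i<n. stable_cf \<alpha> \<beta> (u * \<theta> i))"
      using M by (simp add: char_weighted_iid_sum[OF rd] is_stable_def)
    also have "\<dots> = (\<Prod>i<n. exp (complex_of_real (\<theta> i powr \<alpha>) * E))"
      using \<theta> by (intro prod.cong refl) (simp add: stable_cf_scale[OF \<alpha>] E_def)
    also have "\<dots> = exp (complex_of_real (\<Sum>i<n. \<theta> i powr \<alpha>) * E)"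
      by (simp add: sum_distrib_right flip: exp_sum)
    also have "\<dots> = stable_cf \<alpha> \<beta> (u * c)"
      unfolding n(1) E_def using stable_cf_scale[OF \<alpha> n(2)] by simp
    also have "\<dots> = char (distr M borel (\<lambda>x. c * x + 0)) u"
      unfolding char_distr_affine[OF rd] using M by (simp add: is_stable_def)
    finally show "char (weighted_iid_sum M n \<theta>) u = char (distr M borel (\<lambda>x. c * x + 0)) u" .
  qed
qed

text \<open>Homogeneity fails by the summand \<open>ln c\<close> of
  \<open>ln (\<bar>u\<bar> * c)\<close>; since \<open>\<bar>u\<bar> * sgn u = u\<close>, it
  contributes a term linear in \<open>u\<close>, that is, a translation.\<close>

lemma stable_cf_1_scale:
  assumes "0 \<le> c"
  shows "stable_cf 1 \<beta> (u * c) =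
    exp (complex_of_real c * (- complex_of_real \<bar>u\<bar> * (1 + \<i> * complex_of_real (2 * \<beta> / pi * sgn u * ln \<bar>u\<bar>)))
       + \<i> * complex_of_real (u * (- (2 * \<beta> / pi) * (c * ln c))))"
proof (cases "c = 0 \<or> u = 0")
  case False
  with assms have c: "0 < c" and u: "u \<noteq> 0" by auto
  have "stable_cf 1 \<beta> (u * c) = exp (- complex_of_real (\<bar>u\<bar> * c) *
      (1 + \<i> * complex_of_real (2 * \<beta> / pi * sgn u * (ln \<bar>u\<bar> + ln c))))"
    using c u by (simp add: stable_cf_def abs_mult sgn_mult ln_mult)
  also have "- complex_of_real (\<bar>u\<bar> * c) *
      (1 + \<i> * complex_of_real (2 * \<beta> / pi * sgn u * (ln \<bar>u\<bar> + ln c))) =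
    complex_of_real c * (- complex_of_real \<bar>u\<bar> * (1 + \<i> * complex_of_real (2 * \<beta> / pi * sgn u * ln \<bar>u\<bar>)))
       + \<i> * complex_of_real (u * (- (2 * \<beta> / pi) * (c * ln c)))"
    using u by (cases "0 < u") (simp_all add: complex_eq_iff field_simps)
  finally show ?thesis .
qed (auto simp: stable_cf_def)

text \<open>The homogeneous parts recombine to the original exponent because the weights sum to 1,
  and the translations add up to a multiple of the entropy.\<close>

lemma stable_1_weighted_iid_sum:
  assumes M: "is_stable M 1 \<beta>"
    and \<theta>: "\<And>i. i < n \<Longrightarrow> 0 \<le> \<theta> i" and n: "(\<Sum>i<n. \<theta> i) = 1"
  shows "weighted_iid_sum M n \<theta> =
    distr M borel (\<lambda>x. 1 * x + 2 * \<beta> / pi * (- (\<Sum>i<n. \<theta> i * ln (\<theta> i))))"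
    (is "_ = distr M borel (\<lambda>x. 1 * x + ?d)")
proof (rule Levy_uniqueness)
  have rd: "real_distribution M" using M by (simp add: is_stable_def)
  show "real_distribution (weighted_iid_sum M n \<theta>)"
    by (rule real_distribution_weighted_iid_sum[OF rd])
  show "real_distribution (distr M borel (\<lambda>x. 1 * x + ?d))"
    by (rule real_distribution_distr_borel[OF rd]) simp
  show "char (weighted_iid_sum M n \<theta>) = char (distr M borel (\<lambda>x. 1 * x + ?d))"
  proof
    fix u
    define E where "E = - complex_of_real \<bar>u\<bar> * (1 + \<i> * complex_of_real (2 * \<beta> / pi * sgn u * ln \<bar>u\<bar>))"
    have stable: "stable_cf 1 \<beta> u = exp E" by (simp add: stable_cf_def E_def)
    have "char (weighted_iid_sum M n \<theta>) u = (\<Prod>i<n. stable_cf 1 \<beta> (u * \<theta> i))"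
      using M by (simp add: char_weighted_iid_sum[OF rd] is_stable_def)
    also have "\<dots> = (\<Prod>i<n. exp (complex_of_real (\<theta> i) * E
         + \<i> * complex_of_real (u * (- (2 * \<beta> / pi) * (\<theta> i * ln (\<theta> i))))))"
      using \<theta> by (intro prod.cong refl) (simp only: stable_cf_1_scale E_def lessThan_iff)
    also have "\<dots> = exp (\<Sum>i<n. complex_of_real (\<theta> i) * E
         + \<i> * complex_of_real (u * (- (2 * \<beta> / pi) * (\<theta> i * ln (\<theta> i)))))"
      by (simp only: exp_sum finite_lessThan)
    also have "(\<Sum>i<n. complex_of_real (\<theta> i) * E
         + \<i> * complex_of_real (u * (- (2 * \<beta> / pi) * (\<theta> i * ln (\<theta> i))))) =
       complex_of_real (\<Sum>i<n. \<theta> i) * E + \<i> * complex_of_real (u * ?d)"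
      unfolding minus_mult_commute
      by (simp only: sum.distrib of_real_sum[symmetric] sum_distrib_right[symmetric] sum_distrib_left[symmetric]
          sum_negf[symmetric])
    also have "exp \<dots> = iexp (u * ?d) * stable_cf 1 \<beta> u"
      by (simp only: stable n of_real_1 mult_1 mult_1_right exp_add mult.commute)
    also have "\<dots> = char (distr M borel (\<lambda>x. 1 * x + ?d)) u"
      unfolding char_distr_affine[OF rd] using M by (simp add: is_stable_def)
    finally show "char (weighted_iid_sum M n \<theta>) u = char (distr M borel (\<lambda>x. 1 * x + ?d)) u" .
  qed
qed

subsection \<open>One-sided stable laws\<close>

text \<open>The principal logarithm has imaginary part \<open>- pi / 2\<close> or
  \<open>pi / 2\<close> on the two rays. At \<open>z = - \<i> * u\<close> the kernel
  \<open>exp (- z * x)\<close> is the integrand of the characteristic function at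
  \<open>u\<close>.\<close>

lemma powr_imaginary_axis:
  assumes "0 < \<alpha>" "0 < u"
  shows "(- \<i> * complex_of_real u) powr of_real \<alpha> = of_real (u powr \<alpha>) * cis (- (pi * \<alpha> / 2))"
    and "(\<i> * complex_of_real u) powr of_real \<alpha> = of_real (u powr \<alpha>) * cis (pi * \<alpha> / 2)"
proof -
  have L: "Ln (complex_of_real u * - \<i>) = complex_of_real (ln u) - \<i> * pi / 2"
    "Ln (complex_of_real u * \<i>) = complex_of_real (ln u) + \<i> * pi / 2"
    using assms Ln_times_of_real[of u "- \<i>"] Ln_times_of_real[of u "\<i>"] by (simp_all add: Ln_of_real)
  show "(- \<i> * complex_of_real u) powr of_real \<alpha> = of_real (u powr \<alpha>) * cis (- (pi * \<alpha> / 2))"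
    using assms L(1) by (simp add: powr_def cis_conv_exp mult_ac ring_distribs flip: exp_of_real exp_add)
  show "(\<i> * complex_of_real u) powr of_real \<alpha> = of_real (u powr \<alpha>) * cis (pi * \<alpha> / 2)"
    using assms L(2) by (simp add: powr_def cis_conv_exp mult_ac ring_distribs flip: exp_of_real exp_add)
qed

lemma cos_half_gt_zero:
  assumes "0 < \<alpha>" "\<alpha> < 1"
  shows "0 < cos (pi * \<alpha> / 2)"
proof (rule cos_gt_zero_pi)
  have "0 < pi * \<alpha>" using assms by simp
  thus "- (pi / 2) < pi * \<alpha> / 2" using pi_gt_zero by linarith
qed (use assms in simp)

text \<open>The factor \<open>cis (pi * \<alpha> / 2)\<close> cancels the phase of the power. For
  negative \<open>u\<close> the constant would be the conjugate one, hence the restriction to one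
  ray.\<close>

lemma stable_cf_pos:
  assumes "0 < \<alpha>" "\<alpha> \<noteq> 1" "0 < u"
  shows "stable_cf \<alpha> \<beta> u = exp (- ((1 - \<i> * complex_of_real (\<beta> * tan (pi * \<alpha> / 2))) * cis (pi * \<alpha> / 2) *
    (- \<i> * complex_of_real u) powr of_real \<alpha>))"
proof -
  have "cis h * cis (- h) = 1" for h by (simp add: cis_mult)
  hence *: "a * cis h * (p * cis (- h)) = p * a" for a p h
    by (metis (no_types, opaque_lifting) mult.assoc mult.commute mult.right_neutral)
  show ?thesis
    unfolding powr_imaginary_axis(1)[OF assms(1,3)] * using assms by (simp add: stable_cf_def)
qed

text \<open>For \<beta> = 1 the phases of \<open>1 - \<i> * tan h\<close> and
  \<open>1 + \<i> * tan h\<close> are exactly those of the power on the two rays, so one real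
  constant serves both signs of \<open>u\<close>.\<close>

lemma stable_cf_one_sided:
  assumes "0 < \<alpha>" "\<alpha> < 1"
  shows "stable_cf \<alpha> 1 u = exp (- (complex_of_real (1 / cos (pi * \<alpha> / 2)) *
    (- \<i> * complex_of_real u) powr of_real \<alpha>))"
proof -
  define h where "h = pi * \<alpha> / 2"
  have "cos h > 0" unfolding h_def by (rule cos_half_gt_zero[OF assms])
  hence k: "1 - \<i> * complex_of_real (tan h) = complex_of_real (1 / cos h) * cis (- h)"
    "1 + \<i> * complex_of_real (tan h) = complex_of_real (1 / cos h) * cis h"
    by (simp_all add: complex_eq_iff tan_def)
  consider "u > 0" | "u = 0" | "u < 0" by linarith
  thus ?thesis
  proof cases
    case 1
    thus ?thesis using powr_imaginary_axis(1)[OF assms(1) 1] assms k(1)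
      by (simp add: stable_cf_def mult_ac flip: h_def)
  next
    case 3
    hence "0 < - u" by simp
    from powr_imaginary_axis(2)[OF assms(1) this] show ?thesis using 3 assms k(2)
      by (simp add: stable_cf_def mult_ac flip: h_def)
  qed (use assms in \<open>simp add: stable_cf_def\<close>)
qed

text \<open>The argument of \<open>z\<close> is at most \<open>pi / 2\<close> in absolute value, and
  multiplication by \<alpha> keeps it so. This bounds \<open>exp (- (k * z powr \<alpha>))\<close>
  by 1 for \<open>k > 0\<close>.\<close>

lemma Re_powr_nonneg:
  assumes "0 \<le> Re z" "0 \<le> \<alpha>" "\<alpha> \<le> 1"
  shows "0 \<le> Re (z powr of_real \<alpha>)"
proof (cases "z = 0")
  case False
  hence "\<bar>Im (Ln z)\<bar> \<le> pi / 2" using assms(1) using Re_Ln_pos_le by blast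
  hence "\<alpha> * \<bar>Im (Ln z)\<bar> \<le> 1 * (pi / 2)" using assms by (intro mult_mono) auto
  hence "\<bar>\<alpha> * Im (Ln z)\<bar> \<le> pi / 2" using assms by (simp add: abs_mult)
  hence "0 \<le> cos (\<alpha> * Im (Ln z))" by (intro cos_ge_zero) auto
  thus ?thesis using False by (simp add: powr_def Re_exp)
qed simp

section \<open>Analytic continuation across the imaginary axis\<close>

lemma imaginary_axis:
  assumes "Re z = 0"
  shows "z = - \<i> * complex_of_real (- Im z)"
  using assms by (simp add: complex_eq_iff)

text \<open>The branch cut meets the closed half-plane only at 0, where the power is continuous
  because \<alpha> is positive.\<close>

lemma exp_powr_half_plane:
  assumes "0 < \<alpha>"
  shows "continuous_on {z. 0 \<le> Re z} (\<lambda>z. exp (- (k * z powr of_real \<alpha>)))"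
    and "(\<lambda>z. exp (- (k * z powr of_real \<alpha>))) holomorphic_on {z. 0 < Re z}"
  using assms by (auto intro!: continuous_intros holomorphic_intros simp: complex_nonpos_Reals_iff)

text \<open>A continuous function that is holomorphic off a line is holomorphic. Agreement on the
  axis supplies the continuity; the line is the one with normal vector \<open>1\<close>, as
  \<open>1 \<bullet> z = Re z\<close>.\<close>

lemma holomorphic_on_paste_imaginary_axis:
  assumes U: "open U"
    and f: "continuous_on (U \<inter> {z. Re z \<le> 0}) f" "f holomorphic_on (U \<inter> {z. Re z < 0})"
    and g: "continuous_on (U \<inter> {z. 0 \<le> Re z}) g" "g holomorphic_on (U \<inter> {z. 0 < Re z})"
    and eq: "\<And>z. z \<in> U \<Longrightarrow> Re z = 0 \<Longrightarrow> f z = g z"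
  shows "(\<lambda>z. if Re z \<le> 0 then f z else g z) holomorphic_on U"
proof (rule holomorphic_on_paste_across_line[OF U, of 1 _ 0])
  show "(\<lambda>z. if Re z \<le> 0 then f z else g z) holomorphic_on U \<inter> {z. 1 \<bullet> z < 0}"
    by (rule holomorphic_transform[OF f(2), THEN holomorphic_on_subset]) (auto simp: inner_complex_def)
  show "(\<lambda>z. if Re z \<le> 0 then f z else g z) holomorphic_on U \<inter> {z. 0 < 1 \<bullet> z}"
    by (rule holomorphic_transform[OF g(2), THEN holomorphic_on_subset]) (auto simp: inner_complex_def)
  have UN: "(U \<inter> {z. Re z \<le> 0}) \<union> (U \<inter> {z. 0 \<le> Re z}) = U" by auto
  have "continuous_on ((U \<inter> {z. Re z \<le> 0}) \<union> (U \<inter> {z. 0 \<le> Re z})) (\<lambda>z. if Re z \<le> 0 then f z else g z)"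
    by (rule continuous_on_cases_local)
      (use f g eq in \<open>auto simp: UN intro!: closedin_closed_Int closed_halfspace_Re_le closed_halfspace_Re_ge\<close>)
  thus "continuous_on U (\<lambda>z. if Re z \<le> 0 then f z else g z)" by (simp only: UN)
qed simp

lemma stable_one_sided_support:
  assumes M: "is_stable M \<alpha> 1" and \<alpha>: "0 < \<alpha>" "\<alpha> < 1"
  shows "measure M {..<0} = 0"
proof -
  interpret real_distribution M using M by (simp add: is_stable_def)
  define g where "g A x = complex_of_real (indicator A x)" for A and x :: real
  have int: "integrable M (g A)" if "A \<in> sets borel" for A
    using that unfolding g_def by (intro integrable_of_real integrable_real_indicator) (auto simp: emeasure_eq_measure)
  define P where "P = half_laplace M (g {0..}) (\<lambda>x. x)"
  \<comment> \<open>The two sign changes cancel: the integrand is \<open>exp (- z * x)\<close>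
    restricted to \<open>x < 0\<close>, which is bounded for \<open>Re z <= 0\<close>.\<close>
  define N where "N z = half_laplace M (g {..<0}) uminus (- z)" for z
  define G where "G z = exp (- (complex_of_real (1 / cos (pi * \<alpha> / 2)) * z powr of_real \<alpha>))" for z
  have gP: "integrable M (g {0..})" "(\<lambda>x. x) \<in> borel_measurable M" "\<And>x. g {0..} x \<noteq> 0 \<Longrightarrow> 0 \<le> x"
    and gN: "integrable M (g {..<0})" "uminus \<in> borel_measurable M" "\<And>x. g {..<0} x \<noteq> 0 \<Longrightarrow> 0 \<le> - x"
    by (auto intro!: int simp: g_def indicator_def)
  have contN: "continuous_on {z. Re z \<le> 0} N" unfolding N_def
    by (rule continuous_on_compose2[OF continuous_on_half_laplace[OF gN]]) (auto intro!: continuous_intros)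
  have holN: "N holomorphic_on {z. Re z < 0}" unfolding N_def
    by (rule holomorphic_on_compose_gen[OF _ half_laplace_holomorphic[OF gN], unfolded o_def])
      (auto intro!: holomorphic_intros)
  have P: "continuous_on {z. 0 \<le> Re z} P" "P holomorphic_on {z. 0 < Re z}"
    unfolding P_def using continuous_on_half_laplace[OF gP] half_laplace_holomorphic[OF gP] by auto
  have G: "continuous_on {z. 0 \<le> Re z} G" "G holomorphic_on {z. 0 < Re z}"
    unfolding G_def by (rule exp_powr_half_plane[OF \<alpha>(1)])+
  have char_eq: "N z = G z - P z" if "Re z = 0" for z
  proof -
    define u where "u = - Im z"
    have z: "z = - \<i> * complex_of_real u" using imaginary_axis[OF that] by (simp add: u_def)
    \<comment> \<open>On the axis both halves of the transform converge, and their sum is the full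
      characteristic function.\<close>
    have "P z + N z = (\<integral>x. g {0..} x * exp (- (z * of_real x)) + g {..<0} x * exp (- (- z * of_real (- x))) \<partial>M)"
      unfolding P_def N_def half_laplace_def using that
      by (intro Bochner_Integration.integral_add[symmetric] kernel_integrable[OF gP]
          kernel_integrable[OF gN, of "- z"]) auto
    also have "\<dots> = char M u"
      unfolding char_def g_def z by (intro Bochner_Integration.integral_cong) (auto simp: indicator_def mult_ac)
    also have "\<dots> = G z"
      using M stable_cf_one_sided[OF \<alpha>, of u] by (simp add: is_stable_def G_def z)
    finally show ?thesis by (simp add: algebra_simps)
  qed
  \<comment> \<open>The two halves of the Laplace transform live on opposite half-planes and glue along the
    imaginary axis to a bounded entire function, which decays along the negative axis.\<close>
  define E where "E z = (if Re z \<le> 0 then N z else G z - P z)" for z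
  have "E holomorphic_on UNIV" unfolding E_def
    by (rule holomorphic_on_paste_imaginary_axis)
      (use contN holN char_eq P G in \<open>auto intro!: continuous_intros holomorphic_intros\<close>)
  moreover have "bounded (range E)"
  proof (rule boundedI)
    fix w assume "w \<in> range E"
    then obtain z where w: "w = E z" by auto
    have G: "norm (G z) \<le> 1" if "0 \<le> Re z"
    proof -
      have "cos (pi * \<alpha> / 2) > 0" by (rule cos_half_gt_zero[OF \<alpha>])
      thus ?thesis using Re_powr_nonneg[OF that, of \<alpha>] \<alpha> by (simp add: G_def)
    qed
    have I: "0 \<le> (\<integral>x. norm (g A x) \<partial>M)" for A by simp
    show "norm w \<le> (\<integral>x. norm (g {..<0} x) \<partial>M) + (1 + (\<integral>x. norm (g {0..} x) \<partial>M))"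
    proof (cases "Re z \<le> 0")
      case True
      have "norm (N z) \<le> (\<integral>x. norm (g {..<0} x) \<partial>M)"
        unfolding N_def by (rule norm_half_laplace_le[OF gN]) (use True in auto)
      moreover have "norm w = norm (N z)" using True by (simp add: w E_def)
      ultimately show ?thesis using I[of "{0..}"] by linarith
    next
      case False
      have "norm (P z) \<le> (\<integral>x. norm (g {0..} x) \<partial>M)"
        unfolding P_def by (rule norm_half_laplace_le[OF gP]) (use False in auto)
      moreover have "norm w = norm (G z - P z)" "norm (G z) \<le> 1" using False G by (simp_all add: w E_def)
      ultimately show ?thesis
        using I[of "{..<0}"] norm_triangle_ineq4[of "G z" "P z"] by linarith
    qed
  qed
  ultimately obtain c where c: "E z = c" for z
    using Liouville_theorem[of E] by (auto simp: constant_on_def)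
  \<comment> \<open>Decay along the negative reals identifies the constant as 0, while its value at
    the origin is the mass of the negative half-line.\<close>
  have "(\<lambda>n. half_laplace M (g {..<0}) uminus (of_nat n)) \<longlonglongrightarrow> 0"
    by (rule half_laplace_tendsto_0[OF gN])
      (auto simp: filterlim_real_sequentially g_def indicator_def split: if_splits)
  moreover have "half_laplace M (g {..<0}) uminus (of_nat n) = c" for n
    using c[of "- of_nat n"] by (simp add: E_def N_def)
  ultimately have "c = 0" by (simp add: LIMSEQ_const_iff)
  moreover have "c = of_real (measure M {..<0})"
    using c[of 0] by (simp add: E_def N_def half_laplace_def g_def)
  ultimately show ?thesis by simp
qed

text \<open>The Laplace transform is real and at most 1 at \<open>s > 0\<close>, so
  \<open>exp (- k * s powr \<alpha>)\<close> forces \<open>Im k = 0\<close> and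
  \<open>Re k >= 0\<close>. The first gives \<beta> = 1, the second then \<alpha> < 1.\<close>

lemma nonneg_stable:
  assumes M: "is_stable M \<alpha> \<beta>" and \<alpha>: "0 < \<alpha>" "\<alpha> \<le> 2" "\<alpha> \<noteq> 1" and nonneg: "AE x in M. 0 \<le> x"
  shows "\<alpha> < 1 \<and> \<beta> = 1"
proof -
  interpret real_distribution M using M by (simp add: is_stable_def)
  define g where "g x = complex_of_real (indicator {0..} x)" for x :: real
  have "integrable M g"
    unfolding g_def by (intro integrable_of_real integrable_real_indicator) (auto simp: emeasure_eq_measure)
  moreover have "(\<lambda>x. x) \<in> borel_measurable M" by simp
  moreover have "0 \<le> x" if "g x \<noteq> 0" for x
    using that by (auto simp: g_def indicator_def split: if_splits)
  ultimately have g: "integrable M g" "(\<lambda>x. x) \<in> borel_measurable M" "\<And>x. g x \<noteq> 0 \<Longrightarrow> 0 \<le> x"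
    by blast+
  define P where "P = half_laplace M g (\<lambda>x. x)"
  define h where "h = pi * \<alpha> / 2"
  define k where "k = (1 - \<i> * complex_of_real (\<beta> * tan h)) * cis h"
  define G where "G z = exp (- (k * z powr of_real \<alpha>))" for z
  have P: "continuous_on {z. 0 \<le> Re z} P" "P holomorphic_on {z. 0 < Re z}"
    unfolding P_def using continuous_on_half_laplace[OF g] half_laplace_holomorphic[OF g] by auto
  have G: "continuous_on {z. 0 \<le> Re z} G" "G holomorphic_on {z. 0 < Re z}"
    unfolding G_def by (rule exp_powr_half_plane[OF \<alpha>(1)])+
  have PG: "P (- \<i> * complex_of_real u) = G (- \<i> * complex_of_real u)" if "0 < u" for u
  proof -
    have "P (- \<i> * complex_of_real u) = char M u"
      unfolding P_def half_laplace_def char_def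
      by (rule integral_cong_AE) (use nonneg in \<open>auto simp: g_def indicator_def mult_ac\<close>)
    also have "\<dots> = G (- \<i> * complex_of_real u)"
      using M stable_cf_pos[OF \<alpha>(1,3) that, of \<beta>] by (simp add: is_stable_def G_def k_def h_def)
    finally show ?thesis .
  qed
  \<comment> \<open>The boundary identity holds on one ray only, so paste zero across that ray to propagate it
    inside.\<close>
  define F where "F z = (if Re z \<le> 0 then 0 else P z - G z)" for z
  \<comment> \<open>This disc lies in the open lower half-plane, so its points on the imaginary axis
    are \<open>- \<i> * u\<close> with \<open>u > 0\<close>, where \<open>PG\<close>
    applies.\<close>
  define B :: "complex set" where "B = ball (- \<i>) 1"
  have Im_B: "Im z < 0" if "z \<in> B" for z
    using that abs_Im_le_cmod[of "- \<i> - z"] by (auto simp: B_def dist_norm)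
  have F: "F holomorphic_on B" unfolding F_def
  proof (rule holomorphic_on_paste_imaginary_axis)
    show "0 = P z - G z" if "z \<in> B" "Re z = 0" for z
      using PG[of "- Im z"] Im_B[OF that(1)] imaginary_axis[OF that(2)] by simp
  qed (auto simp: B_def intro!: continuous_intros holomorphic_intros
        continuous_on_subset[OF P(1)] continuous_on_subset[OF G(1)]
        holomorphic_on_subset[OF P(2)] holomorphic_on_subset[OF G(2)])
  have op: "open (B \<inter> {z. Re z < 0})" "open (B \<inter> {z. 0 < Re z})"
    by (auto simp: B_def intro!: open_Int open_halfspace_Re_lt open_halfspace_Re_gt)
  have "Complex (- 1/2) (- 1) \<in> B \<inter> {z. Re z < 0}" "Complex (1/2) (- 1) \<in> B \<inter> {z. 0 < Re z}"
    by (auto simp: B_def dist_norm cmod_def power2_eq_square)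
  hence ne: "B \<inter> {z. Re z < 0} \<noteq> {}" "B \<inter> {z. 0 < Re z} \<noteq> {}" by blast+
  have F0: "F z = 0" if "z \<in> B" for z
  proof (rule analytic_continuation_open[OF op(1) _ ne(1) _ _ F holomorphic_on_const _ that])
    show "open B" "connected B" by (simp_all add: B_def)
  qed (auto simp: F_def)
  \<comment> \<open>A second use of the identity theorem: from the right half of the disc to the
    whole right half-plane.\<close>
  have PG': "P z = G z" if "0 < Re z" for z
  proof (rule analytic_continuation_open[OF op(2) _ ne(2) _ _ P(2) G(2)])
    show "connected {z. 0 < Re z}" by (simp add: convex_connected convex_halfspace_Re_gt)
    show "P z = G z" if "z \<in> B \<inter> {z. 0 < Re z}" for z
      using F0[of z] that by (simp add: F_def)
  qed (use that in \<open>auto simp: open_halfspace_Re_gt\<close>)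
  have P_real: "P (of_real s) = of_real (\<integral>x. indicator {0..} x * exp (- (s * x)) \<partial>M)" for s
    unfolding P_def half_laplace_def g_def
    by (subst integral_complex_of_real[symmetric]) (simp add: exp_of_real flip: of_real_mult of_real_minus)
  have G_real: "G (of_real s) = exp (- (k * of_real (s powr \<alpha>)))" if "0 < s" for s
    using that by (simp add: G_def powr_of_real)
  have Rek: "0 \<le> Re k"
  proof -
    have "norm (P 1) \<le> (\<integral>x. norm (g x) \<partial>M)" unfolding P_def using norm_half_laplace_le[OF g, of 1] by simp
    also have "\<dots> \<le> (\<integral>x. 1 \<partial>M)"
      by (intro integral_mono integrable_norm g(1)) (auto simp: g_def indicator_def)
    finally have "norm (G 1) \<le> 1" using PG'[of 1] prob_space by simp
    thus ?thesis using G_real[of 1] by simp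
  qed
  have Imk: "Im k = 0"
  proof (rule ccontr)
    assume k0: "Im k \<noteq> 0"
    \<comment> \<open>Chosen so that \<open>\<bar>Im k\<bar> * s powr \<alpha> = pi / 2\<close>: the
      sine in the imaginary part of \<open>G s\<close> is then 1 or -1, although \<open>P s\<close>
      is real.\<close>
    define s where "s = (pi / (2 * \<bar>Im k\<bar>)) powr (1 / \<alpha>)"
    have s: "0 < s" "s powr \<alpha> = pi / (2 * \<bar>Im k\<bar>)"
      using k0 \<alpha> by (auto simp: s_def powr_powr)
    have "G (of_real s) = P (of_real s)" using PG'[of "of_real s"] s(1) by simp
    hence "Im (G (of_real s)) = 0" unfolding P_real by simp
    hence "sin (Im k * (pi / (2 * \<bar>Im k\<bar>))) = 0" using G_real[OF s(1)] s(2) by (simp add: Im_exp)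
    moreover have "Im k * (pi / (2 * \<bar>Im k\<bar>)) = pi / 2 \<or> Im k * (pi / (2 * \<bar>Im k\<bar>)) = - (pi / 2)"
      using k0 by (auto simp: abs_if field_simps)
    ultimately show False
      by (metis sin_pi_half sin_minus neg_equal_0_iff_equal zero_neq_one)
  qed
  have h: "0 < h" "h \<le> pi" "h \<noteq> pi / 2" using \<alpha> by (auto simp: h_def)
  have cosh: "cos h \<noteq> 0"
    using h cos_inj_pi[of h "pi/2"] by auto
  have "sin h * (1 - \<beta>) = 0" using Imk cosh by (simp add: k_def tan_def algebra_simps)
  \<comment> \<open>The sine vanishes only at \<open>h = pi\<close>, that is \<alpha> = 2, where
    \<open>k = -1\<close> contradicts \<open>Rek\<close>.\<close>
  moreover have "sin h \<noteq> 0"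
  proof
    assume s: "sin h = 0"
    hence "h = pi" using h sin_gt_zero[of h] by linarith
    thus False using Rek s by (simp add: k_def)
  qed
  ultimately have \<beta>: "\<beta> = 1" by simp
  have "Re k = 1 / cos h"
    using cosh sin_cos_squared_add[of h] by (simp add: k_def \<beta> tan_def field_simps power2_eq_square)
  hence "0 < cos h" using Rek cosh by (auto simp: zero_le_divide_iff)
  hence "h < pi / 2" using h cos_monotone_0_pi_le[of "pi/2" h] by (cases "h < pi / 2") auto
  hence "\<alpha> < 1" by (simp add: h_def)
  with \<beta> show ?thesis by simp
qed

subsection \<open>Stochastic comparison\<close>

lemma AE_nonneg_iff:
  assumes "real_distribution M"
  shows "(AE x in M. 0 \<le> x) \<longleftrightarrow> measure M {..<0::real} = 0"
proof -
  interpret real_distribution M by fact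
  have "(AE x in M. 0 \<le> x) \<longleftrightarrow> emeasure M {..<0} = 0"
    by (subst AE_iff_measurable[of "{..<0}"]) auto
  thus ?thesis by (simp add: emeasure_eq_measure)
qed

text \<open>Reflection conjugates the characteristic function. It reduces nonpositive laws to
  nonnegative ones.\<close>

lemma is_stable_uminus:
  assumes "is_stable M \<alpha> \<beta>" "\<alpha> \<noteq> 1"
  shows "is_stable (distr M borel uminus) \<alpha> (- \<beta>)"
proof -
  have rd: "real_distribution M" using assms by (simp add: is_stable_def)
  have "char (distr M borel uminus) u = stable_cf \<alpha> (- \<beta>) u" for u
    using char_distr_affine[OF rd, of "-1" 0 u] assms by (simp add: is_stable_def stable_cf_def)
  thus ?thesis
    using real_distribution_distr_borel[OF rd, of uminus] by (simp add: is_stable_def)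
qed

section \<open>Necessity, tested on the average of two copies\<close>

lemma Dminus_halves:
  assumes "Dminus M"
  shows "cdf (weighted_iid_sum M 2 (\<lambda>_. 1/2)) t \<le> cdf M t"
  using assms unfolding Dminus_def st_le_def cdf_def
  by (auto simp: dest!: spec[of _ "2::nat"] spec[of _ "\<lambda>_. 1/2"])

lemma halves_entropy: "- (\<Sum>i<2::nat. 1/2 * ln (1/2::real)) = ln 2"
  by (simp add: ln_div numeral_2_eq_2)

text \<open>The average of two copies is a translate to the left by \<open>d > 0\<close>. Iterating
  the comparison gives \<open>F (n * d) <= F 0 <= F (- n * d)\<close> for the distribution function
  \<open>F\<close>, and the limits give \<open>1 <= F 0 <= 0\<close>.\<close>

lemma not_Dminus_stable_1:
  assumes M: "is_stable M 1 \<beta>" and "\<beta> < 0"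
  shows "\<not> Dminus M"
proof
  assume D: "Dminus M"
  have rd: "real_distribution M" using M by (simp add: is_stable_def)
  then interpret real_distribution M .
  define d where "d = - (2 * \<beta> / pi * ln 2)"
  have d: "0 < d" using assms(2) by (simp add: d_def divide_neg_pos mult_neg_pos)
  have W: "weighted_iid_sum M 2 (\<lambda>_. 1/2) = distr M borel (\<lambda>x. 1 * x + (- d))"
    using stable_1_weighted_iid_sum[OF M, of 2 "\<lambda>_. 1/2"] unfolding halves_entropy d_def by simp
  have le: "cdf M (t + d) \<le> cdf M t" for t
    using Dminus_halves[OF D, of t] cdf_distr_affine[OF rd, of 1 "- d" t] unfolding W by simp
  have "cdf M (of_nat n * d) \<le> cdf M 0 \<and> cdf M 0 \<le> cdf M (- of_nat n * d)" for n
  proof (induction n)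
    case (Suc n)
    thus ?case using le[of "of_nat n * d"] le[of "- of_nat (Suc n) * d"] by (simp add: algebra_simps)
  qed simp
  note bounds = this
  have lim: "filterlim (\<lambda>n. real n * d) at_top sequentially"
    using d by (intro filterlim_at_top_mult_tendsto_pos[OF tendsto_const] filterlim_real_sequentially) auto
  have "(\<lambda>n. cdf M (real n * d)) \<longlonglongrightarrow> 1"
    by (rule filterlim_compose[OF cdf_lim_at_top_prob lim])
  hence 1: "1 \<le> cdf M 0" by (rule LIMSEQ_le_const2) (use bounds in auto)
  have "filterlim (\<lambda>n. - real n * d) at_bot sequentially"
    using lim by (simp add: filterlim_uminus_at_bot)
  hence "(\<lambda>n. cdf M (- real n * d)) \<longlonglongrightarrow> 0"
    by (rule filterlim_compose[OF cdf_lim_at_bot])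
  hence "cdf M 0 \<le> 0" by (rule LIMSEQ_le_const) (use bounds in auto)
  with 1 show False by simp
qed

lemma filterlim_realpow_at_top:
  assumes "1 < (c::real)"
  shows "filterlim (\<lambda>n. c ^ n) at_top sequentially"
  by (rule filterlim_at_infinity_imp_filterlim_at_top)
    (use assms in \<open>auto intro!: filterlim_realpow_sequentially_gt1\<close>)

lemma Dminus_stable_imp:
  assumes M: "is_stable M \<alpha> \<beta>" and \<alpha>: "0 < \<alpha>" "\<alpha> \<le> 2" "\<alpha> \<noteq> 1" and D: "Dminus M"
  shows "\<alpha> < 1 \<and> \<beta> = 1"
proof -
  have rd: "real_distribution M" using M by (simp add: is_stable_def)
  then interpret real_distribution M .
  \<comment> \<open>Solves \<open>2 * (1/2) powr \<alpha> = c powr \<alpha>\<close>, so the average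
    is distributed as \<open>c\<close> times the variable. It exceeds 1 exactly when \<alpha> < 1,
    which decides the direction in which iteration pushes \<open>t\<close> to infinity.\<close>
  define c where "c = 2 powr (1 / \<alpha> - 1)"
  have c: "0 < c" by (simp add: c_def)
  have "(\<Sum>i<2::nat. (1/2) powr \<alpha>) = c powr \<alpha>"
    using \<alpha> by (simp add: c_def powr_powr algebra_simps powr_divide powr_diff)
  hence W: "weighted_iid_sum M 2 (\<lambda>_. 1/2) = distr M borel (\<lambda>x. c * x + 0)"
    by (intro stable_weighted_iid_sum[OF M \<alpha>(1,3)]) (simp_all add: c_def)
  have le: "cdf M (t / c) \<le> cdf M t" for t
    using Dminus_halves[OF D, of t] cdf_distr_affine[OF rd c, of 0 t] unfolding W by simp
  have iter: "cdf M t \<le> cdf M (t * c ^ n) \<and> cdf M (t / c ^ n) \<le> cdf M t" for t n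
  proof (induction n)
    case (Suc n)
    thus ?case using le[of "t * c ^ Suc n"] le[of "t / c ^ n"] c by (simp add: mult_ac)
  qed simp
  show ?thesis
  proof (cases "\<alpha> < 1")
    case True
    hence c1: "1 < c" using \<alpha> by (simp add: c_def)
    have cdf0: "cdf M t = 0" if t: "t < 0" for t
    proof -
      have "filterlim (\<lambda>n. - t * c ^ n) at_top sequentially"
        using t c1 by (intro filterlim_tendsto_pos_mult_at_top[OF tendsto_const] filterlim_realpow_at_top) auto
      hence "filterlim (\<lambda>n. t * c ^ n) at_bot sequentially" by (simp add: filterlim_uminus_at_bot)
      hence "(\<lambda>n. cdf M (t * c ^ n)) \<longlonglongrightarrow> 0" by (rule filterlim_compose[OF cdf_lim_at_bot])
      hence "cdf M t \<le> 0" by (rule LIMSEQ_le_const) (use iter in auto)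
      thus ?thesis using cdf_nonneg[of t] by simp
    qed
    have "eventually (\<lambda>t. cdf M t = 0) (at_left 0)"
      using cdf0 by (auto simp: eventually_at_filter)
    hence "(cdf M \<longlongrightarrow> 0) (at_left 0)" by (rule tendsto_eventually)
    \<comment> \<open>The left limit of the distribution function at 0 is the mass of the open
      negative half-line.\<close>
    from tendsto_unique[OF _ cdf_at_left this] have "measure M {..<0} = 0" by simp
    hence "AE x in M. 0 \<le> x" by (simp add: AE_nonneg_iff[OF rd])
    from nonneg_stable[OF M \<alpha> this] show ?thesis .
  next
    case False
    hence c1: "c < 1" using \<alpha> powr_less_mono[of "1 / \<alpha> - 1" 0 2] by (simp add: c_def)
    have cdf1: "cdf M t = 1" if t: "0 < t" for t
    proof -
      have "filterlim (\<lambda>n. t * (1 / c) ^ n) at_top sequentially"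
        using t c1 c by (intro filterlim_tendsto_pos_mult_at_top[OF tendsto_const] filterlim_realpow_at_top) auto
      hence "filterlim (\<lambda>n. t / c ^ n) at_top sequentially" by (simp add: power_divide)
      hence "(\<lambda>n. cdf M (t / c ^ n)) \<longlonglongrightarrow> 1" by (rule filterlim_compose[OF cdf_lim_at_top_prob])
      hence "1 \<le> cdf M t" by (rule LIMSEQ_le_const2) (use iter in auto)
      thus ?thesis using cdf_bounded_prob[of t] by simp
    qed
    have "eventually (\<lambda>t. cdf M t = 1) (at_right 0)"
      using cdf1 by (auto simp: eventually_at_filter)
    hence "(cdf M \<longlongrightarrow> 1) (at_right 0)" by (rule tendsto_eventually)
    moreover have "(cdf M \<longlongrightarrow> cdf M 0) (at_right 0)"
      using cdf_is_right_cont[of 0] by (simp add: continuous_within)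
    ultimately have "cdf M 0 = 1" using tendsto_unique[of "at_right (0::real)"] by fastforce
    hence "prob {..0} = 1" by (simp add: cdf_def)
    hence "AE x in M. x \<in> {..0}" by (subst (asm) prob_eq_1) auto
    \<comment> \<open>For the reflected law \<open>nonneg_stable\<close> would give \<alpha> < 1,
      which is excluded in this case.\<close>
    hence "AE x in distr M borel uminus. 0 \<le> x" by (subst AE_distr_iff) auto
    from nonneg_stable[OF is_stable_uminus[OF M \<alpha>(3)] \<alpha> this] False show ?thesis by simp
  qed
qed

section \<open>Sufficiency, for arbitrary convex weights\<close>

lemma Dminus_stable_1:
  assumes M: "is_stable M 1 \<beta>" and "0 \<le> \<beta>"
  shows "Dminus M"
  unfolding Dminus_def st_le_def
proof (intro allI impI, elim conjE)
  fix n :: nat and \<theta> :: "nat \<Rightarrow> real" and t :: real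
  assume \<theta>: "\<forall>i<n. 0 \<le> \<theta> i" "(\<Sum>i<n. \<theta> i) = 1"
  have rd: "real_distribution M" using M by (simp add: is_stable_def)
  then interpret real_distribution M .
  \<comment> \<open>Nonnegative weights with sum 1 are at most 1, so the entropy is nonnegative and
    the translation goes to the right.\<close>
  have "\<theta> i * ln (\<theta> i) \<le> 0" if "i < n" for i
  proof -
    have "\<theta> i \<le> (\<Sum>i<n. \<theta> i)" using \<theta>(1) that by (intro member_le_sum) auto
    thus ?thesis using \<theta> that by (cases "\<theta> i = 0") (auto intro!: mult_nonneg_nonpos)
  qed
  hence "(\<Sum>i<n. \<theta> i * ln (\<theta> i)) \<le> 0" by (intro sum_nonpos) auto
  hence d: "0 \<le> 2 * \<beta> / pi * (- (\<Sum>i<n. \<theta> i * ln (\<theta> i)))" (is "0 \<le> ?d")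
    using assms(2) by (intro mult_nonneg_nonneg) auto
  have "weighted_iid_sum M n \<theta> = distr M borel (\<lambda>x. 1 * x + ?d)"
    by (rule stable_1_weighted_iid_sum[OF M]) (use \<theta> in auto)
  hence "cdf (weighted_iid_sum M n \<theta>) t = cdf M ((t - ?d) / 1)"
    using cdf_distr_affine[OF rd, of 1 ?d t] by simp
  also have "\<dots> \<le> cdf M t" using d by (intro cdf_nondecreasing) simp
  finally show "measure (weighted_iid_sum M n \<theta>) {..t} \<le> measure M {..t}" by (simp add: cdf_def)
qed

text \<open>Since \<open>x <= x powr \<alpha>\<close> on the unit interval, the scale factor
  \<open>c\<close> is at least 1, and stretching a nonnegative variable makes it stochastically
  larger.\<close>

lemma Dminus_stable_one_sided:
  assumes M: "is_stable M \<alpha> 1" and \<alpha>: "0 < \<alpha>" "\<alpha> < 1"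
  shows "Dminus M"
  unfolding Dminus_def st_le_def
proof (intro allI impI, elim conjE)
  fix n :: nat and \<theta> :: "nat \<Rightarrow> real" and t :: real
  assume \<theta>: "\<forall>i<n. 0 \<le> \<theta> i" "(\<Sum>i<n. \<theta> i) = 1"
  have rd: "real_distribution M" using M by (simp add: is_stable_def)
  then interpret real_distribution M .
  have "\<theta> i \<le> \<theta> i powr \<alpha>" if "i < n" for i
  proof -
    have "\<theta> i \<le> (\<Sum>i<n. \<theta> i)" using \<theta>(1) that by (intro member_le_sum) auto
    thus ?thesis using \<theta> that \<alpha> powr_mono'[of \<alpha> 1 "\<theta> i"] by auto
  qed
  hence S: "1 \<le> (\<Sum>i<n. \<theta> i powr \<alpha>)" unfolding \<theta>(2)[symmetric] by (intro sum_mono) auto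
  define c where "c = (\<Sum>i<n. \<theta> i powr \<alpha>) powr (1 / \<alpha>)"
  have c: "1 \<le> c" "c powr \<alpha> = (\<Sum>i<n. \<theta> i powr \<alpha>)"
    using S \<alpha> by (auto simp: c_def powr_powr ge_one_powr_ge_zero)
  have "weighted_iid_sum M n \<theta> = distr M borel (\<lambda>x. c * x + 0)"
    by (rule stable_weighted_iid_sum[OF M]) (use \<theta> \<alpha> c in auto)
  hence W: "cdf (weighted_iid_sum M n \<theta>) t = cdf M (t / c)"
    using cdf_distr_affine[OF rd, of c 0 t] c by simp
  \<comment> \<open>For \<open>t >= 0\<close> this is monotonicity, as \<open>t / c <= t\<close>.
    For \<open>t < 0\<close> the inequality \<open>t / c >= t\<close> goes the wrong way, but the
    left side is 0 by the support lemma.\<close>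
  also have "\<dots> \<le> cdf M t"
  proof (cases "0 \<le> t")
    case True
    thus ?thesis using c by (intro cdf_nondecreasing) (simp add: divide_le_eq mult_right_le_one_le mult_le_cancel_left1 mult_left_le)
  next
    case False
    hence "t / c < 0" using c by (simp add: divide_neg_pos)
    hence "cdf M (t / c) \<le> measure M {..<0}" unfolding cdf_def by (intro finite_measure_mono) auto
    thus ?thesis using stable_one_sided_support[OF M \<alpha>] cdf_nonneg[of t] by simp
  qed
  finally show "measure (weighted_iid_sum M n \<theta>) {..t} \<le> measure M {..t}" by (simp add: cdf_def)
qed

theorem theorem4:
  fixes M :: "real measure" and \<alpha> \<beta> :: real
  assumes "0 < \<alpha>" and "\<alpha> \<le> 2" and "-1 \<le> \<beta>" and "\<beta> \<le> 1"
    and "is_stable M \<alpha> \<beta>"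
  shows "Dminus M \<longleftrightarrow> ((\<alpha> = 1 \<and> 0 \<le> \<beta>) \<or> (\<alpha> < 1 \<and> \<beta> = 1))"
proof (cases "\<alpha> = 1")
  case True
  thus ?thesis using assms Dminus_stable_1[of M \<beta>] not_Dminus_stable_1[of M \<beta>] by force
next
  case False
  thus ?thesis using assms Dminus_stable_imp[of M \<alpha> \<beta>] Dminus_stable_one_sided[of M \<alpha>] by blast
qed

end
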